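(* Let $V_0>0$ and let $M,N$ be strictly positive coprime integers. For the rational Harper Hamiltonian $$(H\varphi)_q=-\varphi_{q+1}-\varphi_{q-1}-V_0\cos\left(2\pi q\frac{M}{N}\right)\varphi_q,$$ with spectrum $\sigma(H)$ as defined in the context, one has for every $\varphi=(\varphi_0,\dots,\varphi_{N-1})\in(\mathbb{R}^+\setminus\{0\})^N$ $$\min_{q\in\{0,\dots,N-1\}}\left[-\frac{\varphi_{q+1}+\varphi_{q-1}}{\varphi_q}-V_0\cos\left(2\pi q\frac{M}{N}\right)\right]\leqslant\inf\left[\sigma(H)\right]$$ and $$\inf\left[\sigma(H)\right]\leqslant\max_{q\in\{0,\dots,N-1\}}\left[-\frac{\varphi_{q+1}+\varphi_{q-1}}{\varphi_q}-V_0\cos\left(2\pi q\frac{M}{N}\right)\right],$$ where the indices labeling the components of $\varphi$ are taken modulo $N$.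
   Context: Put $V(x)=-V_0\cos(2\pi xM/N)$ for $x\in\mathbb{R}$, which is $N$-periodic. The spectrum $\sigma(H)$ is the set of all real numbers $e(\eta)$, $\eta=(\eta_1,\eta_2)\in[0,1[^2$, for which there is a nonzero complex sequence $(u_q)_{q\in\mathbb{Z}}$ with $$-u_{q+1}-u_{q-1}+V(q+\eta_2)u_q=e(\eta)u_q,\qquad u_{q+N}=\mathrm{e}^{\mathrm{i}2\pi\eta_1}u_q\qquad\text{for all }q\in\mathbb{Z}.$$ (For each $\eta$ the values $e(\eta)$ are the $N$ eigenvalues of a finite Hermitian matrix, and $\sigma(H)$ is the union of these over all $\eta\in[0,1[^2$.) *)

theory Defs
  imports "HOL-Analysis.Analysis"
begin

definition harper_potential :: "real \<Rightarrow> nat \<Rightarrow> nat \<Rightarrow> real \<Rightarrow> real" where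
  "harper_potential V0 M N x = - V0 * cos (2 * pi * x * real M / real N)"

(* Shifted by \<theta>, acting on all bi-infinite sequences; the Hamiltonian H itself is \<theta> = 0. *)
definition harper_op ::
  "real \<Rightarrow> nat \<Rightarrow> nat \<Rightarrow> real \<Rightarrow> (int \<Rightarrow> complex) \<Rightarrow> int \<Rightarrow> complex" where
  "harper_op V0 M N \<theta> u q =
     - u (q + 1) - u (q - 1) + complex_of_real (harper_potential V0 M N (of_int q + \<theta>)) * u q"

(* The union over all \<eta> of the Floquet-Bloch eigenvalues e(\<eta>): \<eta>1 is the quasi-momentum,
   \<eta>2 the shift of the potential. *)
definition harper_spectrum :: "real \<Rightarrow> nat \<Rightarrow> nat \<Rightarrow> real set" where
  "harper_spectrum V0 M N =
     {e. \<exists>\<eta>1\<in>{0..<1}. \<exists>\<eta>2\<in>{0..<1}. \<exists>u :: int \<Rightarrow> complex.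
           (\<exists>q. u q \<noteq> 0) \<and>
           (\<forall>q. harper_op V0 M N \<eta>2 u q = complex_of_real e * u q) \<and>
           (\<forall>q. u (q + int N) = exp (\<i> * complex_of_real (2 * pi * \<eta>1)) * u q)}"

end

theory Submission
  imports Defs
begin

text \<open>
  Let \<open>E(\<eta>)\<close> be the lowest Bloch eigenvalue at \<open>\<eta> = (\<eta>1, \<eta>2)\<close>. At \<open>\<eta> = 0\<close> both bounds are of
  Barta type: a positive test vector compares its local energies \<open>(H \<phi>) q / \<phi> q\<close> with \<open>E(0)\<close>.
  Everything else consists in showing that \<open>E\<close> attains its minimum at \<open>\<eta> = 0\<close>.

  For the quasi-momentum this is a diamagnetic inequality: all hopping amplitudes are \<open>-1\<close>, so
  replacing \<open>u\<close> by its modulus, which is \<open>N\<close>-periodic, does not raise the energy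
  (\<open>harper_form_norm_le\<close>). For the shift \<open>\<theta> = \<eta>2\<close> of the potential the same inequality is used on
  the Fourier side. As \<open>M\<close> and \<open>N\<close> are coprime, \<open>q \<mapsto> exp (2 \<pi> \<i> q M / N)\<close> is a primitive
  character modulo \<open>N\<close>, and the Fourier transform built from it exchanges hopping and potential: the
  cosine turns into a hopping of amplitude \<open>-V0 / 2\<close> whose phase is the only trace of \<open>\<theta>\<close>.
  Replacing the Fourier coefficients by their moduli removes that phase and does not raise the
  energy. Transforming back gives a periodic vector with no more energy at \<open>\<theta> = 0\<close> than the
  original had at \<open>\<theta>\<close> (\<open>harper_form_dual\<close>).

  The lower bound at \<open>\<theta> = 0\<close> (\<open>barta_lower_bound\<close>) is the ground state substitution \<open>w = \<psi> h\<close>: the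
  energy of \<open>w\<close> is the average of the local energies of \<open>\<psi>\<close> with weights \<open>\<bar>w q\<bar>\<^sup>2\<close>, plus the
  nonnegative Dirichlet form \<open>\<Sum>q. \<psi> q * \<psi> (q + 1) * \<bar>h (q + 1) - h q\<bar>\<^sup>2\<close>. For the upper bound
  (\<open>spectrum_upper_bound\<close>), the minimum of the Rayleigh quotient over real periodic vectors is an
  eigenvalue with \<open>\<eta> = 0\<close>, hence in the spectrum, and the quotient of \<open>\<phi>\<close> itself is an average of
  local energies. This eigenvalue also shows that the spectrum is nonempty, without which its
  infimum would carry no information.
\<close>

section \<open>Sums over a period\<close>

lemma sum_period_shift:
  fixes f :: "int \<Rightarrow> 'a::ab_group_add"
  assumes "\<And>q. f (q + int N) = f q"
  shows "(\<Sum>q\<in>{0..<int N}. f (q + 1)) = (\<Sum>q\<in>{0..<int N}. f q)"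
proof (cases "N = 0")
  case False
  have "(\<Sum>q\<in>{0..<int N}. f (q + 1)) = (\<Sum>q\<in>{1..<int N + 1}. f q)"
    by (rule sum.reindex_bij_witness[where i = "\<lambda>q. q - 1" and j = "\<lambda>q. q + 1"]) auto
  also have "{1..<int N + 1} = insert (int N) {1..<int N}"
    using False by auto
  also have "(\<Sum>q\<in>\<dots>. f q) = f 0 + (\<Sum>q\<in>{1..<int N}. f q)"
    using assms[of 0] by simp
  also have "\<dots> = (\<Sum>q\<in>insert 0 {1..<int N}. f q)"
    by simp
  also have "insert 0 {1..<int N} = {0..<int N}"
    using False by auto
  finally show ?thesis .
qed simp

corollary sum_period_shift_neg:
  fixes f :: "int \<Rightarrow> 'a::ab_group_add"
  assumes "\<And>q. f (q + int N) = f q"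
  shows "(\<Sum>q\<in>{0..<int N}. f (q - 1)) = (\<Sum>q\<in>{0..<int N}. f q)"
  using sum_period_shift[of "\<lambda>q. f (q - 1)" N] assms[of "_ - 1"]
  by (simp add: algebra_simps)

lemma periodic_mod:
  assumes "\<And>q. f (q + int N) = f q"
  shows "f q = f (q mod int N)"
proof -
  have "f (r + j * int N) = f r" for r j
  proof (induction j rule: int_induct[where k = 0])
    case (step1 j)
    then show ?case using assms[of "r + j * int N"] by (simp add: algebra_simps)
  next
    case (step2 j)
    then show ?case using assms[of "r + (j - 1) * int N"] by (simp add: algebra_simps)
  qed simp
  from this[of "q mod int N" "q div int N"] show ?thesis
    by simp
qed

section \<open>The finite Fourier transform with a primitive root of unity\<close>

text \<open>The argument \<open>M\<close> selects the character of the integers modulo \<open>N\<close>; taking the Harper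
  frequency itself, and not \<open>1 / N\<close>, makes the transform below turn the potential into hopping
  between nearest neighbours.\<close>

definition char_mod :: "nat \<Rightarrow> nat \<Rightarrow> int \<Rightarrow> complex" where
  "char_mod M N x = cis (2 * pi * of_int x * real M / real N)"

definition fourier :: "nat \<Rightarrow> nat \<Rightarrow> (int \<Rightarrow> complex) \<Rightarrow> int \<Rightarrow> complex" where
  "fourier M N f q = (\<Sum>p\<in>{0..<int N}. f p * char_mod M N (p * q))"

lemma char_mod_add: "char_mod M N (x + y) = char_mod M N x * char_mod M N y"
  by (simp add: char_mod_def cis_mult ring_distribs add_divide_distrib)

lemma cnj_char_mod: "cnj (char_mod M N x) = char_mod M N (- x)"
  by (simp add: char_mod_def cis_cnj)

lemma char_mod_mult_period: "char_mod M N (x * int N) = 1"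
proof (cases "N = 0")
  case False
  then have "char_mod M N (x * int N) = cis (2 * pi * of_int (x * int M))"
    by (simp add: char_mod_def field_simps)
  then show ?thesis
    by (simp only: cis_multiple_2pi Ints_of_int)
qed (simp add: char_mod_def)

lemma char_mod_period: "char_mod M N (x + y * int N) = char_mod M N x"
  by (simp only: char_mod_add char_mod_mult_period mult_1_right)

text \<open>This is where coprimality enters: it makes the character primitive, so that the transform is
  invertible.\<close>

lemma char_mod_eq_1_imp_dvd:
  assumes "coprime M N" "N > 0" "char_mod M N x = 1"
  shows "int N dvd x"
proof -
  have "cos (2 * pi * of_int x * real M / real N) = 1"
    using assms(3) by (simp add: char_mod_def complex_eq_iff)
  then obtain k :: int where "2 * pi * of_int x * real M / real N = of_int k * 2 * pi"
    by (auto simp: cos_one_2pi_int)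
  then have "real_of_int (x * int M) = of_int (k * int N)"
    using \<open>N > 0\<close> by (simp add: field_simps)
  then have "x * int M = k * int N"
    by (simp only: of_int_eq_iff)
  then have "int N dvd x * int M"
    by simp
  moreover have "coprime (int N) (int M)"
    using assms(1) by (simp add: coprime_commute)
  ultimately show ?thesis
    using coprime_dvd_mult_left_iff by blast
qed

text \<open>Shifting the summation index multiplies the sum by \<open>char_mod M N k\<close>, so the sum vanishes
  unless this factor is 1.\<close>

lemma sum_char_mod:
  assumes "coprime M N" "N > 0"
  shows "(\<Sum>q\<in>{0..<int N}. char_mod M N (k * q)) = (if int N dvd k then of_nat N else 0)"
proof (cases "int N dvd k")
  case True
  then obtain j where "k = j * int N"
    by (metis dvd_def mult.commute)
  then have "char_mod M N (k * q) = 1" for q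
    using char_mod_mult_period[of M N "j * q"] by (simp add: ac_simps)
  then show ?thesis
    using True by simp
next
  case False
  let ?S = "\<Sum>q\<in>{0..<int N}. char_mod M N (k * q)"
  have "?S = (\<Sum>q\<in>{0..<int N}. char_mod M N (k * (q + 1)))"
    by (rule sum_period_shift[symmetric]) (simp add: ring_distribs char_mod_period)
  also have "\<dots> = ?S * char_mod M N k"
    by (simp add: ring_distribs char_mod_add sum_distrib_right)
  finally have "?S * (char_mod M N k - 1) = 0"
    by (simp add: algebra_simps)
  moreover have "char_mod M N k \<noteq> 1"
    using char_mod_eq_1_imp_dvd[OF assms] False by blast
  ultimately show ?thesis
    using False by simp
qed

text \<open>The factor \<open>N\<close> comes from leaving \<^const>\<open>fourier\<close> unnormalised.\<close>

lemma parseval: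
  assumes "coprime M N" "N > 0"
  shows "(\<Sum>q\<in>{0..<int N}. fourier M N f q * cnj (fourier M N g q)) =
         of_nat N * (\<Sum>p\<in>{0..<int N}. f p * cnj (g p))"
proof -
  let ?I = "{0..<int N}"
  have "(\<Sum>q\<in>?I. fourier M N f q * cnj (fourier M N g q)) =
      (\<Sum>q\<in>?I. \<Sum>p\<in>?I. \<Sum>r\<in>?I. f p * cnj (g r) * char_mod M N ((p - r) * q))"
    unfolding fourier_def cnj_sum sum_product
    by (intro sum.cong refl)
      (simp add: cnj_char_mod left_diff_distrib char_mod_add[of M N "_ * _" "- (_ * _)", simplified])
  also have "\<dots> = (\<Sum>p\<in>?I. \<Sum>r\<in>?I. \<Sum>q\<in>?I. f p * cnj (g r) * char_mod M N ((p - r) * q))"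
    by (subst sum.swap, rule sum.cong[OF refl], rule sum.swap)
  also have "\<dots> = (\<Sum>p\<in>?I. \<Sum>r\<in>?I. if r = p then of_nat N * (f p * cnj (g p)) else 0)"
  proof (intro sum.cong refl)
    fix p r assume pr: "p \<in> ?I" "r \<in> ?I"
    have "int N dvd p - r \<longleftrightarrow> r = p"
      using pr by (auto simp flip: mod_eq_dvd_iff)
    then show "(\<Sum>q\<in>?I. f p * cnj (g r) * char_mod M N ((p - r) * q)) =
        (if r = p then of_nat N * (f p * cnj (g p)) else 0)"
      by (simp add: sum_char_mod[OF assms] flip: sum_distrib_left)
  qed
  also have "\<dots> = of_nat N * (\<Sum>p\<in>?I. f p * cnj (g p))"
    by (simp add: sum_distrib_left)
  finally show ?thesis .
qed

lemma fourier_period: "fourier M N f (q + int N) = fourier M N f q"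
  by (simp add: fourier_def ring_distribs char_mod_period)

lemma fourier_modulate: "fourier M N (\<lambda>p. char_mod M N p * f p) q = fourier M N f (q + 1)"
  by (simp add: fourier_def ring_distribs char_mod_add ac_simps)

lemma fourier_shift:
  assumes "\<And>p. f (p + int N) = f p"
  shows "fourier M N (\<lambda>p. f (p - 1)) q = char_mod M N q * fourier M N f q"
proof -
  have "fourier M N (\<lambda>p. f (p - 1)) q
      = (\<Sum>p\<in>{0..<int N}. (\<lambda>p. f p * char_mod M N ((p + 1) * q)) (p - 1))"
    by (simp add: fourier_def)
  also have "\<dots> = (\<Sum>p\<in>{0..<int N}. f p * char_mod M N ((p + 1) * q))"
    by (rule sum_period_shift_neg)
      (use char_mod_period[of M N "(_ + 1) * q" q] assms in \<open>simp add: algebra_simps\<close>)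
  also have "\<dots> = char_mod M N q * fourier M N f q"
    by (simp add: fourier_def ring_distribs char_mod_add sum_distrib_left ac_simps)
  finally show ?thesis .
qed

lemma sum_norm_fourier:
  assumes "coprime M N" "N > 0"
  shows "(\<Sum>q\<in>{0..<int N}. (cmod (fourier M N f q))\<^sup>2) =
         real N * (\<Sum>p\<in>{0..<int N}. (cmod (f p))\<^sup>2)"
proof -
  have "complex_of_real (\<Sum>q\<in>{0..<int N}. (cmod (fourier M N f q))\<^sup>2) =
      complex_of_real (real N * (\<Sum>p\<in>{0..<int N}. (cmod (f p))\<^sup>2))"
    using parseval[OF assms, of f f] by (simp add: complex_norm_square del: of_real_power)
  then show ?thesis
    by (simp only: of_real_eq_iff)
qed

text \<open>The duality of the Harper model: the hopping energy of the transform is the potential energy of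
  the function, and conversely.\<close>

lemma fourier_hopping:
  assumes "coprime M N" "N > 0"
  shows "(\<Sum>q\<in>{0..<int N}. fourier M N f (q + 1) * cnj (fourier M N f q)) =
         of_nat N * (\<Sum>p\<in>{0..<int N}. char_mod M N p * of_real ((cmod (f p))\<^sup>2))"
  using parseval[OF assms, of "\<lambda>p. char_mod M N p * f p" f]
  unfolding fourier_modulate complex_norm_square by (simp add: mult.assoc)

lemma fourier_potential:
  assumes "coprime M N" "N > 0" and per: "\<And>p. f (p + int N) = f p"
  shows "(\<Sum>q\<in>{0..<int N}. char_mod M N q * of_real ((cmod (fourier M N f q))\<^sup>2)) =
         of_nat N * (\<Sum>p\<in>{0..<int N}. f p * cnj (f (p + 1)))"
proof -
  have "(\<Sum>q\<in>{0..<int N}. char_mod M N q * of_real ((cmod (fourier M N f q))\<^sup>2)) =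
      of_nat N * (\<Sum>p\<in>{0..<int N}. f (p - 1) * cnj (f p))"
    using parseval[OF assms(1,2), of "\<lambda>p. f (p - 1)" f]
    by (simp add: fourier_shift per complex_norm_square ac_simps del: of_real_power)
  also have "(\<Sum>p\<in>{0..<int N}. f (p - 1) * cnj (f p)) = (\<Sum>p\<in>{0..<int N}. f p * cnj (f (p + 1)))"
    using sum_period_shift_neg[of "\<lambda>p. f p * cnj (f (p + 1))" N] per[of "_ + 1"] per
    by (simp add: algebra_simps)
  finally show ?thesis .
qed

section \<open>The energy form and the lower bound\<close>

text \<open>For periodic \<open>w\<close> this is \<open>\<langle>w, H w\<rangle>\<close> over one period, with the two hopping terms merged by a
  shift of the summation index.\<close>

definition harper_form ::
  "real \<Rightarrow> nat \<Rightarrow> nat \<Rightarrow> real \<Rightarrow> (int \<Rightarrow> complex) \<Rightarrow> real" where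
  "harper_form V0 M N \<theta> w =
     (\<Sum>q\<in>{0..<int N}. harper_potential V0 M N (of_int q + \<theta>) * (cmod (w q))\<^sup>2
                        - 2 * Re (w (q + 1) * cnj (w q)))"

lemma harper_potential_char:
  "harper_potential V0 M N (of_int q + \<theta>) =
     - V0 * Re (cis (2 * pi * \<theta> * real M / real N) * char_mod M N q)"
proof -
  have "cis (2 * pi * \<theta> * real M / real N) * char_mod M N q
      = cis (2 * pi * (of_int q + \<theta>) * real M / real N)"
    by (simp add: char_mod_def cis_mult ring_distribs add_divide_distrib add.commute)
  then show ?thesis
    by (simp add: harper_potential_def)
qed

lemma harper_form_char:
  "harper_form V0 M N \<theta> w =
     - V0 * Re (cis (2 * pi * \<theta> * real M / real N) *
        (\<Sum>q\<in>{0..<int N}. char_mod M N q * of_real ((cmod (w q))\<^sup>2)))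
     - 2 * Re (\<Sum>q\<in>{0..<int N}. w (q + 1) * cnj (w q))"
  unfolding harper_form_def harper_potential_char sum_subtractf sum_distrib_left Re_sum
  by (simp add: sum_distrib_left algebra_simps)

text \<open>A Bloch function need not be periodic, but the Bloch phase cancels in \<open>u (q + 1) * cnj (u q)\<close>,
  so the energy identity holds over one period as for periodic functions.\<close>

lemma eigenvalue_eq_harper_form:
  assumes eig: "\<And>q. harper_op V0 M N \<theta> u q = complex_of_real e * u q"
    and bloch: "\<And>q. u (q + int N) = z * u q" "cmod z = 1"
  shows "e * (\<Sum>q\<in>{0..<int N}. (cmod (u q))\<^sup>2) = harper_form V0 M N \<theta> u"
proof -
  have zz: "z * cnj z = 1"
    using bloch(2) complex_norm_square[of z] by simp
  have per: "(\<lambda>q. Re (u (q + 1) * cnj (u q))) (q + int N) = (\<lambda>q. Re (u (q + 1) * cnj (u q))) q" for q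
  proof -
    have "u (q + 1 + int N) * cnj (u (q + int N)) = (z * cnj z) * (u (q + 1) * cnj (u q))"
      unfolding bloch(1) by (simp add: ac_simps)
    then show ?thesis by (simp add: zz add.assoc add.commute[of "int N"])
  qed
  have "e * (cmod (u q))\<^sup>2 = harper_potential V0 M N (of_int q + \<theta>) * (cmod (u q))\<^sup>2
      - Re (u (q + 1) * cnj (u q)) - Re (u q * cnj (u (q - 1)))" for q
  proof -
    have "of_real (e * (cmod (u q))\<^sup>2) = harper_op V0 M N \<theta> u q * cnj (u q)"
      unfolding eig by (simp add: complex_norm_square del: of_real_power)
    also have "\<dots> = of_real (harper_potential V0 M N (of_int q + \<theta>) * (cmod (u q))\<^sup>2)
        - u (q + 1) * cnj (u q) - u (q - 1) * cnj (u q)"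
      by (simp add: harper_op_def complex_norm_square algebra_simps del: of_real_power)
    finally have "Re (of_real (e * (cmod (u q))\<^sup>2)) = Re \<dots>"
      by simp
    then show ?thesis by (simp add: algebra_simps)
  qed
  then have "e * (\<Sum>q\<in>{0..<int N}. (cmod (u q))\<^sup>2) =
      (\<Sum>q\<in>{0..<int N}. harper_potential V0 M N (of_int q + \<theta>) * (cmod (u q))\<^sup>2)
      - (\<Sum>q\<in>{0..<int N}. Re (u (q + 1) * cnj (u q)))
      - (\<Sum>q\<in>{0..<int N}. Re (u q * cnj (u (q - 1))))"
    by (simp only: sum_distrib_left sum_subtractf)
  also have "(\<Sum>q\<in>{0..<int N}. Re (u q * cnj (u (q - 1))))
      = (\<Sum>q\<in>{0..<int N}. Re (u (q + 1) * cnj (u q)))"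
    using sum_period_shift_neg[of "\<lambda>q. Re (u (q + 1) * cnj (u q))", OF per] by simp
  finally show ?thesis
    by (simp only: harper_form_def sum_subtractf flip: sum_distrib_left)
qed

lemma harper_form_norm_le:
  "harper_form V0 M N \<theta> (\<lambda>q. of_real (cmod (u q))) \<le> harper_form V0 M N \<theta> u"
proof -
  have "Re (u (q + 1) * cnj (u q)) \<le> Re (of_real (cmod (u (q + 1))) * cnj (of_real (cmod (u q))))" for q
    using complex_Re_le_cmod[of "u (q + 1) * cnj (u q)"] by (simp add: norm_mult)
  then show ?thesis
    unfolding harper_form_def norm_of_real abs_norm_cancel
    by (intro sum_mono diff_mono mult_left_mono order_refl) auto
qed

text \<open>The vector \<open>w\<close> is the transform of the moduli of the Fourier coefficients of \<open>a\<close>. By duality its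
  hopping energy is the one of \<open>a\<close>, while in its potential energy the hopping of the coefficients
  with phases depending on \<open>\<theta>\<close> is replaced by the hopping of their moduli, which has the lowest
  possible energy. The factors \<open>N\<^sup>2\<close> account for transforming twice without normalisation.\<close>

lemma harper_form_dual:
  assumes "V0 > 0" "coprime M N" "N > 0"
    and per: "\<And>q. a (q + int N) = a q"
  obtains w where "\<And>q. w (q + int N) = w q"
    and "(\<Sum>q\<in>{0..<int N}. (cmod (w q))\<^sup>2) = (real N)\<^sup>2 * (\<Sum>q\<in>{0..<int N}. (cmod (a q))\<^sup>2)"
    and "harper_form V0 M N 0 w \<le> (real N)\<^sup>2 * harper_form V0 M N \<theta> a"
proof
  let ?I = "{0..<int N}" and ?c = "cis (2 * pi * \<theta> * real M / real N)"
  define v where "v = fourier M N a"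
  define b where "b = (\<lambda>p. complex_of_real (cmod (v p)))"
  define w where "w = fourier M N b"
  have v_per: "v (p + int N) = v p" for p
    by (simp add: v_def fourier_period)
  have b_per: "b (p + int N) = b p" for p
    by (simp add: b_def v_per)
  show "w (q + int N) = w q" for q
    by (simp add: w_def fourier_period)
  show "(\<Sum>q\<in>?I. (cmod (w q))\<^sup>2) = (real N)\<^sup>2 * (\<Sum>q\<in>?I. (cmod (a q))\<^sup>2)"
    using sum_norm_fourier[OF assms(2,3), of b] sum_norm_fourier[OF assms(2,3), of a]
    by (simp add: w_def b_def v_def power2_eq_square)

  define K where "K = (\<Sum>p\<in>?I. char_mod M N p * of_real ((cmod (v p))\<^sup>2))"
  define X where "X = (\<Sum>p\<in>?I. v (p + 1) * cnj (v p))"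
  define Y where "Y = (\<Sum>p\<in>?I. cmod (v p) * cmod (v (p + 1)))"
  have Ka: "K = of_nat N * (\<Sum>q\<in>?I. a q * cnj (a (q + 1)))"
    unfolding K_def v_def by (rule fourier_potential[where f = a, OF assms(2,3) per])
  have Xa: "X = of_nat N * (\<Sum>q\<in>?I. char_mod M N q * of_real ((cmod (a q))\<^sup>2))"
    unfolding X_def v_def by (rule fourier_hopping[OF assms(2,3)])
  have wK: "(\<Sum>q\<in>?I. w (q + 1) * cnj (w q)) = of_nat N * K"
    unfolding w_def K_def fourier_hopping[OF assms(2,3)] by (simp add: b_def)
  have wY: "(\<Sum>q\<in>?I. char_mod M N q * of_real ((cmod (w q))\<^sup>2)) = of_nat N * of_real Y"
    unfolding w_def Y_def fourier_potential[where f = b, OF assms(2,3) b_per] by (simp add: b_def)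
  have "Re (?c * X) \<le> cmod (?c * X)"
    by (rule complex_Re_le_cmod)
  also have "\<dots> = cmod X"
    by (simp add: norm_mult)
  also have "\<dots> \<le> Y"
    unfolding X_def Y_def
    by (rule sum_norm_le) (simp add: norm_mult mult.commute)
  finally have XY: "V0 * Re (?c * X) \<le> V0 * Y"
    using \<open>V0 > 0\<close> by simp
  have "Re K = real N * Re (\<Sum>q\<in>?I. a (q + 1) * cnj (a q))"
    unfolding Ka Re_sum by (simp add: algebra_simps)
  then have "real N * harper_form V0 M N \<theta> a = - V0 * Re (?c * X) - 2 * Re K"
    unfolding harper_form_char Xa by (simp add: algebra_simps)
  moreover have "harper_form V0 M N 0 w = real N * (- V0 * Y - 2 * Re K)"
    unfolding harper_form_char wK wY by (simp add: algebra_simps)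
  ultimately show "harper_form V0 M N 0 w \<le> (real N)\<^sup>2 * harper_form V0 M N \<theta> a"
    using XY by (simp add: power2_eq_square mult.assoc mult_left_mono)
qed

text \<open>Completing the square bounds each hopping term by two diagonal terms with ratios of values of
  \<open>\<psi>\<close>; after shifting one of them, they add up to the hopping part of the local energy. The defect
  is the Dirichlet form of \<open>w / \<psi>\<close>.\<close>

lemma barta_lower_bound:
  assumes pos: "\<And>q. \<psi> q > (0::real)" and per: "\<And>q. \<psi> (q + int N) = \<psi> q"
    and w_per: "\<And>q. w (q + int N) = w q"
    and le: "\<And>q. q \<in> {0..<int N} \<Longrightarrow>
      m \<le> harper_potential V0 M N (of_int q + \<theta>) - (\<psi> (q + 1) + \<psi> (q - 1)) / \<psi> q"
  shows "m * (\<Sum>q\<in>{0..<int N}. (cmod (w q))\<^sup>2) \<le> harper_form V0 M N \<theta> w"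
proof -
  let ?I = "{0..<int N}" and ?n = "\<lambda>q. (cmod (w q))\<^sup>2"
  have "2 * Re (w (q + 1) * cnj (w q)) \<le> ?n q * (\<psi> (q + 1) / \<psi> q) + ?n (q + 1) * (\<psi> q / \<psi> (q + 1))" for q
  proof -
    let ?x = "cmod (w q)" and ?y = "cmod (w (q + 1))" and ?s = "\<psi> q" and ?t = "\<psi> (q + 1)"
    have "2 * Re (w (q + 1) * cnj (w q)) \<le> 2 * (?x * ?y)"
      using complex_Re_le_cmod[of "w (q + 1) * cnj (w q)"] by (simp add: norm_mult mult.commute)
    also have "\<dots> \<le> ?x\<^sup>2 * (?t / ?s) + ?y\<^sup>2 * (?s / ?t)"
    proof -
      have "0 \<le> (?x * ?t - ?y * ?s)\<^sup>2 / (?s * ?t)"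
        using pos[of q] pos[of "q + 1"] by simp
      also have "\<dots> = ?x\<^sup>2 * (?t / ?s) + ?y\<^sup>2 * (?s / ?t) - 2 * (?x * ?y)"
        using pos[of q] pos[of "q + 1"] by (simp add: field_simps power2_eq_square)
      finally show ?thesis by simp
    qed
    finally show ?thesis .
  qed
  then have "(\<Sum>q\<in>?I. 2 * Re (w (q + 1) * cnj (w q)))
      \<le> (\<Sum>q\<in>?I. ?n q * (\<psi> (q + 1) / \<psi> q)) + (\<Sum>q\<in>?I. ?n (q + 1) * (\<psi> q / \<psi> (q + 1)))"
    by (simp add: sum_mono flip: sum.distrib)
  also have "(\<Sum>q\<in>?I. ?n (q + 1) * (\<psi> q / \<psi> (q + 1))) = (\<Sum>q\<in>?I. ?n q * (\<psi> (q - 1) / \<psi> q))"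
    using sum_period_shift[of "\<lambda>q. ?n q * (\<psi> (q - 1) / \<psi> q)" N] per per[of "_ - 1"] w_per
    by (simp add: algebra_simps)
  finally have hop: "(\<Sum>q\<in>?I. 2 * Re (w (q + 1) * cnj (w q)))
      \<le> (\<Sum>q\<in>?I. ?n q * ((\<psi> (q + 1) + \<psi> (q - 1)) / \<psi> q))"
    by (simp add: add_divide_distrib distrib_left sum.distrib)
  have "m * (\<Sum>q\<in>?I. ?n q) \<le> (\<Sum>q\<in>?I. (harper_potential V0 M N (of_int q + \<theta>)
      - (\<psi> (q + 1) + \<psi> (q - 1)) / \<psi> q) * ?n q)"
    unfolding sum_distrib_left by (intro sum_mono mult_right_mono le) auto
  also have "\<dots> = (\<Sum>q\<in>?I. harper_potential V0 M N (of_int q + \<theta>) * ?n q)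
      - (\<Sum>q\<in>?I. ?n q * ((\<psi> (q + 1) + \<psi> (q - 1)) / \<psi> q))"
    by (simp only: left_diff_distrib sum_subtractf mult.commute[of "_ / _"])
  also have "\<dots> \<le> harper_form V0 M N \<theta> w"
    using hop by (simp add: harper_form_def sum_subtractf)
  finally show ?thesis .
qed

text \<open>An eigenfunction at arbitrary \<open>\<eta>\<close> is carried to \<open>\<eta> = 0\<close> in two steps, first taking its modulus,
  then the modulus of the Fourier coefficients; the result is compared with \<open>\<psi>\<close>.\<close>

lemma spectrum_lower_bound:
  assumes "V0 > 0" "coprime M N" "N > 0"
    and pos: "\<And>q. \<psi> q > 0" and per: "\<And>q. \<psi> (q + int N) = \<psi> q"
    and le: "\<And>q. q \<in> {0..<int N} \<Longrightarrow>
      m \<le> harper_potential V0 M N (of_int q) - (\<psi> (q + 1) + \<psi> (q - 1)) / \<psi> q"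
    and e: "e \<in> harper_spectrum V0 M N"
  shows "m \<le> e"
proof -
  let ?I = "{0..<int N}"
  obtain \<eta> \<theta> u q0 where u0: "u q0 \<noteq> 0"
    and eig: "\<And>q. harper_op V0 M N \<theta> u q = complex_of_real e * u q"
    and bloch: "\<And>q. u (q + int N) = exp (\<i> * complex_of_real (2 * pi * \<eta>)) * u q"
    using e unfolding harper_spectrum_def by blast
  have z: "cmod (exp (\<i> * complex_of_real (2 * pi * \<eta>))) = 1"
    by (rule norm_exp_i_times)
  define a where "a = (\<lambda>q. complex_of_real (cmod (u q)))"
  have a_per: "a (q + int N) = a q" for q
    unfolding a_def bloch norm_mult z by simp
  obtain w where w_per: "\<And>q. w (q + int N) = w q"
    and w_norm: "(\<Sum>q\<in>?I. (cmod (w q))\<^sup>2) = (real N)\<^sup>2 * (\<Sum>q\<in>?I. (cmod (a q))\<^sup>2)"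
    and w_form: "harper_form V0 M N 0 w \<le> (real N)\<^sup>2 * harper_form V0 M N \<theta> a"
    using harper_form_dual[where a = a and \<theta> = \<theta>, OF assms(1-3) a_per] by blast
  define S where "S = (\<Sum>q\<in>?I. (cmod (u q))\<^sup>2)"
  have "m * (\<Sum>q\<in>?I. (cmod (w q))\<^sup>2) \<le> harper_form V0 M N 0 w"
    by (rule barta_lower_bound[where \<psi> = \<psi> and w = w and N = N, OF pos per w_per]) (use le in simp)
  also have "\<dots> \<le> (real N)\<^sup>2 * harper_form V0 M N \<theta> a"
    by (rule w_form)
  also have "\<dots> \<le> (real N)\<^sup>2 * harper_form V0 M N \<theta> u"
    unfolding a_def by (intro mult_left_mono harper_form_norm_le) simp
  also have "\<dots> = (real N)\<^sup>2 * (e * S)"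
    using eigenvalue_eq_harper_form[OF eig bloch z] by (simp add: S_def)
  finally have "(real N)\<^sup>2 * (m * S) \<le> (real N)\<^sup>2 * (e * S)"
    by (simp add: w_norm a_def S_def ac_simps)
  then have "m * S \<le> e * S"
    using \<open>N > 0\<close> by simp
  moreover have "S > 0"
  proof -
    have "u (q0 mod int N) \<noteq> 0"
      using periodic_mod[of a N q0, OF a_per] u0 by (auto simp: a_def)
    moreover have "q0 mod int N \<in> ?I"
      using \<open>N > 0\<close> by simp
    ultimately show ?thesis
      unfolding S_def by (intro sum_pos2[of _ "q0 mod int N"]) auto
  qed
  ultimately show ?thesis
    by simp
qed

section \<open>An eigenvalue below the Rayleigh quotient of a test vector\<close>

lemma quadratic_nonneg_imp_linear_zero:
  fixes A B :: real
  assumes "\<And>t. 0 \<le> A * t\<^sup>2 + B * t"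
  shows "B = 0"
proof (rule ccontr)
  assume B: "B \<noteq> 0"
  \<comment> \<open>a step small enough for the linear term to dominate, also when \<open>A\<close> is zero or negative\<close>
  define t where "t = - B / (\<bar>A\<bar> + 1)"
  have "A * t\<^sup>2 + B * t = B\<^sup>2 * (A - (\<bar>A\<bar> + 1)) / (\<bar>A\<bar> + 1)\<^sup>2"
  proof -
    have "A * (- B / x)\<^sup>2 + B * (- B / x) = B\<^sup>2 * (A - x) / x\<^sup>2" if "x \<noteq> 0" for x
      using that by (simp add: field_simps power2_eq_square)
    from this[of "\<bar>A\<bar> + 1"] show ?thesis
      unfolding t_def by linarith
  qed
  moreover have "B\<^sup>2 * (A - (\<bar>A\<bar> + 1)) < 0"
    using B by (intro mult_pos_neg) auto
  ultimately have "A * t\<^sup>2 + B * t < 0"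
    by (simp add: divide_less_0_iff add_nonneg_eq_0_iff)
  then show False
    using assms[of t] by linarith
qed

text \<open>The Rayleigh quotient attains its minimum by compactness of the unit sphere, and its first
  variation at a minimiser \<open>f\<close> is the eigenvalue equation. The index set is a finite set of any type
  because the dimension is a variable of the theorem. Functions restricted to \<open>I\<close> then live in the
  product topology, where Tychonoff's theorem supplies the compactness.\<close>

lemma symmetric_kernel_min_eigenvector:
  fixes A :: "'i \<Rightarrow> 'i \<Rightarrow> real"
  assumes fin: "finite I" and ne: "I \<noteq> {}"
    and sym: "\<And>i j. i \<in> I \<Longrightarrow> j \<in> I \<Longrightarrow> A i j = A j i"
  obtains m f where "\<exists>i\<in>I. f i \<noteq> 0"
    and "\<And>i. i \<in> I \<Longrightarrow> (\<Sum>j\<in>I. A i j * f j) = m * f i"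
    and "\<And>g. m * (\<Sum>i\<in>I. (g i)\<^sup>2) \<le> (\<Sum>i\<in>I. \<Sum>j\<in>I. A i j * g i * g j)"
proof -
  define Q where "Q g = (\<Sum>i\<in>I. \<Sum>j\<in>I. A i j * g i * g j)" for g :: "'i \<Rightarrow> real"
  define n where "n g = (\<Sum>i\<in>I. (g i)\<^sup>2)" for g :: "'i \<Rightarrow> real"
  define K where "K = (PiE I (\<lambda>_. {-1..1})) \<inter> {g. n g = 1}"
  have cont_n: "continuous_on UNIV n" and cont_Q: "continuous_on UNIV Q"
    unfolding n_def[abs_def] Q_def[abs_def]
    by (intro continuous_intros continuous_on_product_coordinates)+
  have "compact (PiE I (\<lambda>_. {-1..1::real}))"
  proof -
    let ?B = "\<lambda>i. if i \<in> I then {-1..1} else {undefined :: real}"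
    have "PiE I (\<lambda>_. {-1..1}) = PiE UNIV ?B"
      by (auto simp: PiE_iff extensional_def split: if_splits)
    moreover have "compactin (product_topology (\<lambda>_. euclidean) UNIV) (PiE UNIV ?B)"
      by (simp add: compactin_PiE)
    ultimately show ?thesis
      by (simp add: euclidean_product_topology del: PiE_UNIV_domain)
  qed
  moreover have "closed {g. n g = 1}"
    using cont_n by (intro closed_Collect_eq continuous_on_const)
  ultimately have "compact K"
    unfolding K_def by (rule compact_Int_closed)
  have n_scale: "n (\<lambda>i. c * g i) = c\<^sup>2 * n g" and Q_scale: "Q (\<lambda>i. c * g i) = c\<^sup>2 * Q g" for c g
    by (simp_all add: n_def Q_def sum_distrib_left power2_eq_square ac_simps)
  have normalise: "\<exists>h\<in>K. Q h = Q g / n g" if "n g \<noteq> 0" for g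
  proof -
    have ng: "n g > 0"
      using that by (simp add: n_def less_le sum_nonneg)
    define c where "c = 1 / sqrt (n g)"
    have c: "c\<^sup>2 = 1 / n g"
      using ng by (simp add: c_def power_divide)
    let ?h = "restrict (\<lambda>i. c * g i) I"
    have nh: "n ?h = n (\<lambda>i. c * g i)" and Qh: "Q ?h = Q (\<lambda>i. c * g i)"
      by (simp_all add: n_def Q_def cong: sum.cong)
    have n1: "n ?h = 1"
      using ng by (simp add: nh n_scale c)
    have "?h i \<in> {-1..1}" if "i \<in> I" for i
    proof -
      have "(?h i)\<^sup>2 \<le> n ?h"
        unfolding n_def by (rule member_le_sum[OF that _ fin]) simp
      then have "\<bar>?h i\<bar> \<le> 1"
        by (simp only: n1 abs_square_le_1)
      then show ?thesis unfolding atLeastAtMost_iff by linarith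
    qed
    then have "?h \<in> K"
      using n1 by (auto simp: K_def)
    then show ?thesis
      using ng by (intro bexI[of _ ?h]) (auto simp: Qh Q_scale c)
  qed
  have "n (\<lambda>_. 1) \<noteq> 0"
    using fin ne by (simp add: n_def)
  then have "K \<noteq> {}"
    using normalise by blast
  then obtain f where "f \<in> K" and min_K: "\<And>g. g \<in> K \<Longrightarrow> Q f \<le> Q g"
    using continuous_attains_inf[OF \<open>compact K\<close>] continuous_on_subset[OF cont_Q] by (metis subset_UNIV)
  then have nf: "n f = 1"
    by (simp add: K_def)
  have min: "Q f * n g \<le> Q g" for g
  proof (cases "n g = 0")
    case True
    then have "\<forall>i\<in>I. g i = 0"
      using fin by (simp add: n_def sum_nonneg_eq_0_iff)
    then show ?thesis
      by (simp add: True Q_def)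
  next
    case False
    then have "n g > 0"
      by (simp add: n_def less_le sum_nonneg)
    moreover have "Q f \<le> Q g / n g"
      using normalise[OF False] min_K by metis
    ultimately show ?thesis
      by (simp add: field_simps)
  qed
  \<comment> \<open>first variation in the direction of the \<open>i\<close>-th unit vector\<close>
  have "(\<Sum>j\<in>I. A i j * f j) = Q f * f i" if i: "i \<in> I" for i
  proof -
    define d where "d = (\<lambda>j. if j = i then 1 else 0 :: real)"
    let ?L = "\<Sum>j\<in>I. A i j * f j"
    have nt: "n (\<lambda>j. f j + t * d j) = n f + 2 * t * f i + t\<^sup>2" for t
    proof -
      have "n (\<lambda>j. f j + t * d j) = n f + 2 * t * (\<Sum>j\<in>I. f j * d j) + t\<^sup>2 * (\<Sum>j\<in>I. (d j)\<^sup>2)"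
        unfolding n_def sum_distrib_left
        by (simp add: power2_eq_square algebra_simps flip: sum.distrib)
      moreover have "(\<Sum>j\<in>I. f j * d j) = f i" "(\<Sum>j\<in>I. (d j)\<^sup>2) = 1"
        using i fin by (simp_all add: d_def if_distrib[of "\<lambda>x. _ * x"] if_distrib[of "\<lambda>x. x\<^sup>2"] cong: if_cong)
      ultimately show ?thesis
        by simp
    qed
    have Qt: "Q (\<lambda>j. f j + t * d j) = Q f + 2 * t * ?L + t\<^sup>2 * Q d" for t
    proof -
      have "Q (\<lambda>j. f j + t * d j) = Q f
          + t * (\<Sum>k\<in>I. \<Sum>j\<in>I. A k j * d k * f j) + t * (\<Sum>k\<in>I. \<Sum>j\<in>I. A k j * f k * d j)
          + t\<^sup>2 * Q d"
        unfolding Q_def sum_distrib_left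
        by (simp add: power2_eq_square algebra_simps flip: sum.distrib)
      moreover have "(\<Sum>k\<in>I. \<Sum>j\<in>I. A k j * d k * f j) = ?L"
      proof -
        have "(\<Sum>k\<in>I. \<Sum>j\<in>I. A k j * d k * f j) = (\<Sum>k\<in>I. if k = i then ?L else 0)"
          by (intro sum.cong) (auto simp: d_def)
        then show ?thesis using i fin by simp
      qed
      moreover have "(\<Sum>k\<in>I. \<Sum>j\<in>I. A k j * f k * d j) = ?L"
      proof -
        have "(\<Sum>k\<in>I. \<Sum>j\<in>I. A k j * f k * d j) = (\<Sum>k\<in>I. A k i * f k)"
          using i fin by (simp add: d_def if_distrib cong: if_cong)
        then show ?thesis using sym i by simp
      qed
      ultimately show ?thesis by simp
    qed
    have "0 \<le> (Q d - Q f) * t\<^sup>2 + 2 * (?L - Q f * f i) * t" for t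
      using min[of "\<lambda>j. f j + t * d j"] unfolding nt Qt nf by (simp add: algebra_simps)
    then have "2 * (?L - Q f * f i) = 0"
      by (rule quadratic_nonneg_imp_linear_zero)
    then show ?thesis by simp
  qed
  moreover have "\<exists>i\<in>I. f i \<noteq> 0"
  proof (rule ccontr)
    assume "\<not> (\<exists>i\<in>I. f i \<noteq> 0)"
    then show False
      using nf by (simp add: n_def)
  qed
  moreover have "Q f * (\<Sum>i\<in>I. (g i)\<^sup>2) \<le> (\<Sum>i\<in>I. \<Sum>j\<in>I. A i j * g i * g j)" for g
    using min[of g] by (simp only: Q_def n_def)
  ultimately show thesis
    using that by blast
qed

lemma spectrum_upper_bound:
  assumes "N > 0"
    and pos: "\<And>q. \<psi> q > 0" and per: "\<And>q. \<psi> q = \<psi> (q mod int N)"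
    and ge: "\<And>q. q \<in> {0..<int N} \<Longrightarrow>
      harper_potential V0 M N (of_int q) - (\<psi> (q + 1) + \<psi> (q - 1)) / \<psi> q \<le> m"
  obtains e where "e \<in> harper_spectrum V0 M N" "e \<le> m"
proof -
  let ?I = "{0..<int N}" and ?V = "\<lambda>i. harper_potential V0 M N (of_int i)"
  \<comment> \<open>The two hopping terms are kept separate, so that they add up correctly for \<open>N = 1\<close> and \<open>N = 2\<close>,
    where the neighbours of a site coincide.\<close>
  define A where "A i j = (if i = j then ?V i else 0)
      - (if j = (i + 1) mod int N then 1 else 0) - (if j = (i - 1) mod int N then 1 else 0)" for i j
  have swap: "j = (i + 1) mod int N \<longleftrightarrow> i = (j - 1) mod int N" if "i \<in> ?I" "j \<in> ?I" for i j
  proof -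
    have "j = (i + 1) mod int N \<longleftrightarrow> j mod int N = (i + 1) mod int N"
      using that by simp
    also have "\<dots> \<longleftrightarrow> i mod int N = (j - 1) mod int N"
      unfolding mod_eq_dvd_iff by (metis (no_types, opaque_lifting) diff_diff_eq2 dvd_minus_iff minus_diff_eq add.commute)
    finally show ?thesis
      using that by simp
  qed
  have sym: "A i j = A j i" if "i \<in> ?I" "j \<in> ?I" for i j
    using swap[OF that] swap[OF that(2,1)] unfolding A_def by (cases "i = j") auto
  have A_sum: "(\<Sum>j\<in>?I. A i j * f j) = ?V i * f i - f ((i + 1) mod int N) - f ((i - 1) mod int N)"
    if "i \<in> ?I" for i f
  proof -
    have "(\<Sum>j\<in>?I. A i j * f j) = (\<Sum>j\<in>?I. (if j = i then ?V i * f i else 0))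
       - (\<Sum>j\<in>?I. (if j = (i + 1) mod int N then f j else 0))
       - (\<Sum>j\<in>?I. (if j = (i - 1) mod int N then f j else 0))"
      unfolding sum_subtractf[symmetric] A_def by (intro sum.cong) (auto simp: left_diff_distrib)
    then show ?thesis
      using that \<open>N > 0\<close> by simp
  qed
  obtain e f where f0: "\<exists>i\<in>?I. f i \<noteq> 0"
    and eig: "\<And>i. i \<in> ?I \<Longrightarrow> (\<Sum>j\<in>?I. A i j * f j) = e * f i"
    and min: "\<And>g. e * (\<Sum>i\<in>?I. (g i)\<^sup>2) \<le> (\<Sum>i\<in>?I. \<Sum>j\<in>?I. A i j * g i * g j)"
    by (rule symmetric_kernel_min_eigenvector[of ?I A]) (use sym \<open>N > 0\<close> in auto)
  define u where "u q = complex_of_real (f (q mod int N))" for q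
  have "harper_op V0 M N 0 u q = complex_of_real e * u q" for q
  proof -
    define i where "i = q mod int N"
    have i: "i \<in> ?I"
      using \<open>N > 0\<close> by (simp add: i_def)
    have V: "harper_potential V0 M N (of_int q + 0) = ?V i"
    proof -
      have "char_mod M N q = char_mod M N (i + (q div int N) * int N)"
        by (simp add: i_def)
      also have "\<dots> = char_mod M N i"
        by (rule char_mod_period)
      finally show ?thesis
        using harper_potential_char[of V0 M N _ 0] by simp
    qed
    have "harper_op V0 M N 0 u q
        = of_real (?V i * f i - f ((i + 1) mod int N) - f ((i - 1) mod int N))"
      unfolding harper_op_def V u_def by (simp add: i_def mod_simps)
    then show ?thesis
      using eig[OF i] unfolding A_sum[OF i] by (simp only: u_def i_def of_real_mult)
  qed
  moreover have "\<exists>q. u q \<noteq> 0"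
  proof -
    obtain i where "i \<in> ?I" "f i \<noteq> 0"
      using f0 by blast
    then show ?thesis
      by (intro exI[of _ i]) (simp add: u_def)
  qed
  moreover have "u (q + int N) = exp (\<i> * complex_of_real (2 * pi * 0)) * u q" for q
    by (simp add: u_def)
  ultimately have "e \<in> harper_spectrum V0 M N"
    unfolding harper_spectrum_def by (intro CollectI bexI[of _ 0] exI[of _ u]) auto
  moreover have "e \<le> m"
  proof -
    have "e * (\<Sum>i\<in>?I. (\<psi> i)\<^sup>2) \<le> (\<Sum>i\<in>?I. \<psi> i * (\<Sum>j\<in>?I. A i j * \<psi> j))"
      using min[of \<psi>] by (simp add: sum_distrib_left ac_simps)
    also have "\<dots> = (\<Sum>i\<in>?I. (?V i - (\<psi> (i + 1) + \<psi> (i - 1)) / \<psi> i) * (\<psi> i)\<^sup>2)"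
    proof (intro sum.cong refl)
      fix i assume "i \<in> ?I"
      then show "\<psi> i * (\<Sum>j\<in>?I. A i j * \<psi> j) = (?V i - (\<psi> (i + 1) + \<psi> (i - 1)) / \<psi> i) * (\<psi> i)\<^sup>2"
        using pos[of i]
        unfolding A_sum[OF \<open>i \<in> ?I\<close>] per[of "i + 1", symmetric] per[of "i - 1", symmetric]
        by (simp add: field_simps power2_eq_square)
    qed
    also have "\<dots> \<le> (\<Sum>i\<in>?I. m * (\<psi> i)\<^sup>2)"
      by (intro sum_mono mult_right_mono ge) auto
    finally have "e * (\<Sum>i\<in>?I. (\<psi> i)\<^sup>2) \<le> m * (\<Sum>i\<in>?I. (\<psi> i)\<^sup>2)"
      by (simp add: sum_distrib_left)
    moreover have "(\<Sum>i\<in>?I. (\<psi> i)\<^sup>2) > 0"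
      using \<open>N > 0\<close> pos by (intro sum_pos) (auto simp: less_imp_neq[THEN not_sym])
    ultimately show ?thesis by simp
  qed
  ultimately show thesis
    using that by blast
qed

section \<open>Enclosure of the bottom of the spectrum\<close>

theorem corollary1:
  fixes V0 :: real and M N :: nat and \<phi> :: "int \<Rightarrow> real"
  assumes "V0 > 0" and "M > 0" and "N > 0" and "coprime M N"
    and "\<And>q. q \<in> {0..<int N} \<Longrightarrow> \<phi> q > 0"
  shows "Min ((\<lambda>q. - (\<phi> ((q + 1) mod int N) + \<phi> ((q - 1) mod int N)) / \<phi> q
                   - V0 * cos (2 * pi * of_int q * (real M / real N))) ` {0..<int N})
           \<le> Inf (harper_spectrum V0 M N)
         \<and> Inf (harper_spectrum V0 M N)
           \<le> Max ((\<lambda>q. - (\<phi> ((q + 1) mod int N) + \<phi> ((q - 1) mod int N)) / \<phi> q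
                   - V0 * cos (2 * pi * of_int q * (real M / real N))) ` {0..<int N})"
proof -
  define loc where "loc = (\<lambda>q. - (\<phi> ((q + 1) mod int N) + \<phi> ((q - 1) mod int N)) / \<phi> q
                   - V0 * cos (2 * pi * of_int q * (real M / real N)))"
  define \<psi> where "\<psi> = (\<lambda>q. \<phi> (q mod int N))"
  have pos: "\<psi> q > 0" for q
    unfolding \<psi>_def using assms(3) by (intro assms(5)) simp
  have local: "harper_potential V0 M N (of_int q) - (\<psi> (q + 1) + \<psi> (q - 1)) / \<psi> q = loc q"
    if "q \<in> {0..<int N}" for q
    using that by (simp add: \<psi>_def loc_def harper_potential_def minus_divide_left)
  have lower: "Min (loc ` {0..<int N}) \<le> e" if "e \<in> harper_spectrum V0 M N" for e
    by (rule spectrum_lower_bound[where \<psi> = \<psi>, OF assms(1,4,3) pos _ _ that])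
      (auto simp: local, simp add: \<psi>_def)
  obtain e where "e \<in> harper_spectrum V0 M N" "e \<le> Max (loc ` {0..<int N})"
    by (rule spectrum_upper_bound[where \<psi> = \<psi>, OF assms(3) pos, of V0 M "Max (loc ` {0..<int N})"])
      (auto simp: local, simp add: \<psi>_def)
  then have "Min (loc ` {0..<int N}) \<le> Inf (harper_spectrum V0 M N)"
    and "Inf (harper_spectrum V0 M N) \<le> Max (loc ` {0..<int N})"
    using lower by (auto intro!: cInf_greatest cInf_lower2 bdd_belowI)
  then show ?thesis
    unfolding loc_def by blast
qed

end
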